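(* For the load balancing and Santa Claus problems, there are exponentiated proportional allocations (EP-allocations) that achieve a competitive ratio of $1+\epsilon$ and $1-\epsilon$ respectively, for any $\epsilon>0$.
   Context: There are $n$ divisible items that arrive online and $m$ agents; $p_{i,j}>0$ is the weight of item $j$ for agent $i$, revealed when item $j$ arrives. A feasible allocation is a matrix $X=(x_{i,j})\in[0,1]^{m\times n}$ with $\sum_{i=1}^m x_{i,j}=1$ for every $j$. The load of agent $i$ is $\ell_i(P,X)=\sum_{j} x_{i,j}p_{i,j}$, where $P=(p_{i,j})$. The load balancing problem is to minimize $\max_i\ell_i(P,X)$, and the Santa Claus problem is to maximize $\min_i\ell_i(P,X)$, over feasible $X$. An EP-allocation allocates item $j$ on arrival by first exponentiating the weights $p_{i,j}$ to $p_{i,j}^{\alpha}$, for some fixed $\alpha\in\mathbb{R}$ (the exponentiation constant) that only depends on the objective being optimized (its finite value being chosen according to the desired accuracy $\epsilon$), and then allocating proportionally using learned parameters $\mathbf{w}\in\mathbb{R}_{>0}^m$, one per agent, given in advance: $x_{i,j}=\dfrac{p_{i,j}^{\alpha}w_i}{\sum_{i'=1}^m p_{i',j}^{\alpha}w_{i'}}$. Competitive ratio $1+\epsilon$ for load balancing means that the maximum load is at most $(1+\epsilon)$ times the offline optimum; competitive ratio $1-\epsilon$ for Santa Claus means that the minimum load is at least $(1-\epsilon)$ times the offline optimum.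
   Formalization: The exponentiation constant α may depend on the number of agents m as well as on the objective and ε (not on the items or weights); no α depending only on the objective and ε works for all m. *)

theory Defs
  imports Complex_Main
begin

text \<open>
  Agents are the numbers \<open>i < m\<close> and items the numbers \<open>j < n\<close>; \<open>P i j\<close> and \<open>X i j\<close>
  are the weight and the allocated fraction of item \<open>j\<close> for agent \<open>i\<close>.  Values outside
  these index ranges are irrelevant.  All notions are meant for \<open>m \<ge> 1\<close>.
\<close>

definition feasible :: "nat \<Rightarrow> nat \<Rightarrow> (nat \<Rightarrow> nat \<Rightarrow> real) \<Rightarrow> bool" where
  "feasible m n X \<longleftrightarrow>
     (\<forall>i<m. \<forall>j<n. 0 \<le> X i j \<and> X i j \<le> 1) \<and> (\<forall>j<n. (\<Sum>i<m. X i j) = 1)"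

definition load :: "nat \<Rightarrow> (nat \<Rightarrow> nat \<Rightarrow> real) \<Rightarrow> (nat \<Rightarrow> nat \<Rightarrow> real) \<Rightarrow> nat \<Rightarrow> real" where
  "load n P X i = (\<Sum>j<n. X i j * P i j)"

definition max_load :: "nat \<Rightarrow> nat \<Rightarrow> (nat \<Rightarrow> nat \<Rightarrow> real) \<Rightarrow> (nat \<Rightarrow> nat \<Rightarrow> real) \<Rightarrow> real" where
  "max_load m n P X = Max (load n P X ` {..<m})"

definition min_load :: "nat \<Rightarrow> nat \<Rightarrow> (nat \<Rightarrow> nat \<Rightarrow> real) \<Rightarrow> (nat \<Rightarrow> nat \<Rightarrow> real) \<Rightarrow> real" where
  "min_load m n P X = Min (load n P X ` {..<m})"

text \<open>
  Offline optima.  For \<open>m \<ge> 1\<close> and positive weights the set of feasible allocations is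
  nonempty and the loads are bounded, so the real-valued infimum and supremum are meaningful.
\<close>

definition opt_load_balancing :: "nat \<Rightarrow> nat \<Rightarrow> (nat \<Rightarrow> nat \<Rightarrow> real) \<Rightarrow> real" where
  "opt_load_balancing m n P = (INF X\<in>{X. feasible m n X}. max_load m n P X)"

definition opt_santa_claus :: "nat \<Rightarrow> nat \<Rightarrow> (nat \<Rightarrow> nat \<Rightarrow> real) \<Rightarrow> real" where
  "opt_santa_claus m n P = (SUP X\<in>{X. feasible m n X}. min_load m n P X)"

definition load_balancing_competitive ::
  "real \<Rightarrow> nat \<Rightarrow> nat \<Rightarrow> (nat \<Rightarrow> nat \<Rightarrow> real) \<Rightarrow> (nat \<Rightarrow> nat \<Rightarrow> real) \<Rightarrow> bool" where
  "load_balancing_competitive c m n P X \<longleftrightarrow>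
     feasible m n X \<and> max_load m n P X \<le> c * opt_load_balancing m n P"

definition santa_claus_competitive ::
  "real \<Rightarrow> nat \<Rightarrow> nat \<Rightarrow> (nat \<Rightarrow> nat \<Rightarrow> real) \<Rightarrow> (nat \<Rightarrow> nat \<Rightarrow> real) \<Rightarrow> bool" where
  "santa_claus_competitive c m n P X \<longleftrightarrow>
     feasible m n X \<and> min_load m n P X \<ge> c * opt_santa_claus m n P"

text \<open>
  The exponentiated proportional allocation.  Column \<open>j\<close> depends on \<open>P\<close> only through
  column \<open>j\<close> of \<open>P\<close>, so it can be computed when item \<open>j\<close> arrives; the number of items
  does not occur.
\<close>

definition ep_allocation ::
  "nat \<Rightarrow> real \<Rightarrow> (nat \<Rightarrow> real) \<Rightarrow> (nat \<Rightarrow> nat \<Rightarrow> real) \<Rightarrow> nat \<Rightarrow> nat \<Rightarrow> real" where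
  "ep_allocation m \<alpha> w P i j =
     (P i j powr \<alpha> * w i) / (\<Sum>i'<m. P i' j powr \<alpha> * w i')"

end

theory Submission
  imports Defs "HOL-Analysis.Function_Topology"
begin

text \<open>
  For every exponent \<open>\<alpha>\<close> there are positive weights \<open>w\<close> for which all agents have the same
  load \<open>L\<close>.  Writing \<open>w i = l i powr \<alpha>\<close>, item \<open>j\<close> is split by a soft minimum
  (\<open>\<alpha>\<close> very negative) or soft maximum (\<open>\<alpha>\<close> very positive) of the priced weights
  \<open>l i * P i j\<close>; its priced cost is within a factor \<open>1 \<plusminus> \<epsilon>\<close> of the true minimum or maximum
  over \<open>i\<close>, for \<open>\<alpha>\<close> depending only on \<open>m\<close> and \<open>\<epsilon>\<close>.  Since the loads are equal, the total
  priced cost is \<open>L\<close> times the sum of the prices, so weak linear programming duality with the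
  dual solution \<open>l\<close> compares \<open>L\<close> with the load of any feasible allocation.
\<close>

section \<open>Compactness of the simplex and existence of equalising weights\<close>

text \<open>Weights are functions on the whole type under the product topology. Pinning the
  coordinates outside \<open>I\<close> to 0 makes the simplex a closed subset of the cube with all
  sides \<open>{0..1}\<close>, which is compact by Tychonoff.\<close>

lemma compact_simplex:
  fixes I :: "'a set"
  assumes "finite I"
  shows "compact {w :: 'a \<Rightarrow> real. (\<forall>i. 0 \<le> w i) \<and> (\<forall>i. i \<notin> I \<longrightarrow> w i = 0) \<and> (\<Sum>i\<in>I. w i) = 1}"
    (is "compact ?K")
proof -
  have *: "continuous_on UNIV (\<lambda>w :: 'a \<Rightarrow> real. w i)" for i
    by (rule continuous_on_product_coordinates)
  have "compactin (product_topology (\<lambda>_. euclideanreal) UNIV) (\<Pi>\<^sub>E i\<in>(UNIV :: 'a set). {0..1::real})"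
    by (subst compactin_PiE) auto
  then have cube: "compact (\<Pi>\<^sub>E i\<in>(UNIV :: 'a set). {0..1::real})"
    by (simp only: euclidean_product_topology compactin_euclidean_iff)
  have K_eq: "?K = {w. \<forall>i. 0 \<le> w i} \<inter> {w. \<forall>i. i \<notin> I \<longrightarrow> w i = 0} \<inter> {w. (\<Sum>i\<in>I. w i) = 1}"
    by auto
  have "closed {w :: 'a \<Rightarrow> real. \<forall>i. 0 \<le> w i}"
    by (intro closed_Collect_all closed_Collect_le * continuous_on_const)
  moreover have "closed {w :: 'a \<Rightarrow> real. \<forall>i. i \<notin> I \<longrightarrow> w i = 0}"
  proof (intro closed_Collect_all)
    show "closed {w :: 'a \<Rightarrow> real. i \<notin> I \<longrightarrow> w i = 0}" for i
      by (cases "i \<in> I") (auto intro!: closed_Collect_eq * continuous_on_const)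
  qed
  moreover have "closed {w :: 'a \<Rightarrow> real. (\<Sum>i\<in>I. w i) = 1}"
    by (intro closed_Collect_eq continuous_on_sum * continuous_on_const)
  ultimately have "closed ?K"
    unfolding K_eq by (intro closed_Int)
  moreover have "?K \<subseteq> (\<Pi>\<^sub>E i\<in>UNIV. {0..1})"
  proof (intro subsetI PiE_I)
    fix w i
    assume w: "w \<in> ?K"
    have "w i \<le> 1"
    proof (cases "i \<in> I")
      case True
      then have "w i \<le> sum w I" using w assms by (intro member_le_sum) auto
      then show ?thesis using w by simp
    qed (use w in simp)
    then show "w i \<in> {0..1}" using w by simp
  qed simp
  ultimately show ?thesis
    using compact_Int_closed[OF cube, of ?K] by (simp only: inf.absorb2)
qed

text \<open>
  The weights are found by minimising the largest load over the closed simplex: if some agents had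
  a smaller load, shifting weight to them would strictly lower every maximal load.
\<close>

lemma ex_weights_equal_loads:
  fixes c p :: "'a \<Rightarrow> 'b \<Rightarrow> real"
  assumes I: "finite I" "I \<noteq> {}" and J: "finite J"
    and c: "\<And>i j. i \<in> I \<Longrightarrow> j \<in> J \<Longrightarrow> 0 < c i j"
    and p: "\<And>i j. i \<in> I \<Longrightarrow> j \<in> J \<Longrightarrow> 0 < p i j"
  obtains w L where "\<And>i. i \<in> I \<Longrightarrow> 0 < w i"
    "\<And>i. i \<in> I \<Longrightarrow> (\<Sum>j\<in>J. c i j * w i / (\<Sum>k\<in>I. c k j * w k) * p i j) = L"
proof (cases "J = {}")
  case True
  then show thesis using that[of "\<lambda>_. 1" 0] by simp
next
  case False
  define D where "D w j = (\<Sum>k\<in>I. c k j * w k)" for w j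
  define f where "f i w = (\<Sum>j\<in>J. c i j * w i / D w j * p i j)" for i w
  define F where "F w = (MAX i\<in>I. f i w)" for w
  define K where "K = {w :: 'a \<Rightarrow> real. (\<forall>i. 0 \<le> w i) \<and> (\<forall>i. i \<notin> I \<longrightarrow> w i = 0) \<and> (\<Sum>i\<in>I. w i) = 1}"
  have K_pos: "\<exists>i\<in>I. 0 < w i" if "w \<in> K" for w
  proof (rule ccontr)
    assume "\<not> ?thesis"
    then have "(\<Sum>i\<in>I. w i) \<le> 0" by (intro sum_nonpos) (auto simp: not_less)
    with that show False by (simp add: K_def)
  qed
  have D_pos: "0 < D w j" if "w \<in> K" "j \<in> J" for w j
  proof -
    obtain i where "i \<in> I" "w i > 0" using K_pos[OF \<open>w \<in> K\<close>] by blast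
    then show ?thesis unfolding D_def
      using I c[OF _ \<open>j \<in> J\<close>] \<open>w \<in> K\<close>
      by (intro sum_pos2[of _ i]) (auto simp: K_def less_imp_le)
  qed
  have cont_f: "continuous_on K (f i)" if "i \<in> I" for i
  proof -
    have "continuous_on K (\<lambda>w :: 'a \<Rightarrow> real. w i)" for i
      by (rule continuous_on_subset[OF continuous_on_product_coordinates]) simp
    moreover have "\<forall>w\<in>K. (\<Sum>k\<in>I. c k j * w k) \<noteq> 0" if "j \<in> J" for j
      using D_pos[OF _ that] by (force simp: D_def)
    ultimately show ?thesis unfolding f_def D_def by (intro continuous_intros)
  qed
  have F_ge: "f i w \<le> F w" if "i \<in> I" for i w
    unfolding F_def using I that by (intro Max_ge) auto
  have F_less: "F w < u \<longleftrightarrow> (\<forall>i\<in>I. f i w < u)" for w u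
    unfolding F_def using I by (subst Max_less_iff) auto
  have cont_F: "continuous_on K F"
  proof -
    have "continuous_on K (\<lambda>w. MAX i\<in>A. f i w)" if "finite A" "A \<noteq> {}" "A \<subseteq> I" for A
      using that
    proof (induction rule: finite_ne_induct)
      case (singleton i)
      then have "continuous_on K (f i)" by (intro cont_f) auto
      then show ?case by simp
    next
      case (insert i A)
      then have "continuous_on K (\<lambda>w. max (f i w) (MAX i\<in>A. f i w))"
        by (intro continuous_on_max cont_f insert.IH) auto
      then show ?case using insert.hyps by simp
    qed
    from this[of I] I show ?thesis unfolding F_def by auto
  qed
  have "K \<noteq> {}"
  proof -
    obtain i where "i \<in> I" using I by blast
    then have "(\<lambda>k. if k = i then 1 else 0) \<in> K" using I by (auto simp: K_def)
    then show ?thesis by blast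
  qed
  moreover have "compact K" unfolding K_def by (rule compact_simplex[OF I(1)])
  ultimately obtain w where w: "w \<in> K" and w_min: "\<And>v. v \<in> K \<Longrightarrow> F w \<le> F v"
    using continuous_attains_inf[of K F] cont_F by blast
  have w_ge: "w i \<ge> 0" for i using w by (simp add: K_def)
  have f_zero: "f i w = 0" if "w i = 0" for i using that by (simp add: f_def)
  have F_pos: "F w > 0"
  proof -
    obtain i where i: "i \<in> I" "w i > 0" using K_pos[OF w] by blast
    then have "f i w > 0" unfolding f_def
      using J False c p D_pos[OF w] by (intro sum_pos) auto
    with F_ge[OF i(1), of w] show ?thesis by simp
  qed
  have equal: "f i w = F w" if "i \<in> I" for i
  proof (rule ccontr)
    assume neq: "f i w \<noteq> F w"
    \<comment> \<open>\<open>T\<close> collects the agents strictly below the maximum,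
      \<open>u\<close> is the uniform distribution on \<open>T\<close>, and \<open>v s\<close> moves
      from \<open>w\<close> towards \<open>u\<close> along a segment inside
      \<open>K\<close>.\<close>
    define T where "T = {k \<in> I. f k w < F w}"
    have T: "finite T" "T \<subseteq> I" "i \<in> T"
      using I neq that F_ge[OF that, of w] by (auto simp: T_def)
    define u where "u k = (if k \<in> T then 1 / card T else 0)" for k
    define v where "v s k = (1 - s) * w k + s * u k" for s :: real and k
    have "(\<Sum>k\<in>I. u k) = 1"
    proof -
      have "(\<Sum>k\<in>I. u k) = (\<Sum>k\<in>T. u k)"
        using I T by (intro sum.mono_neutral_right) (auto simp: u_def)
      also have "\<dots> = 1" using T by (auto simp: u_def)
      finally show ?thesis .
    qed
    then have "u \<in> K" using T by (auto simp: K_def u_def)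
    have v_in: "v s \<in> K" if "0 \<le> s" "s \<le> 1" for s
    proof -
      have "(\<Sum>k\<in>I. v s k) = (1 - s) * (\<Sum>k\<in>I. w k) + s * (\<Sum>k\<in>I. u k)"
        by (simp add: v_def sum.distrib sum_distrib_left)
      then show ?thesis using that w \<open>u \<in> K\<close> by (auto simp: K_def v_def)
    qed
    have D_v: "D (v s) j = (1 - s) * D w j + s * D u j" for s j
      by (simp add: D_def v_def sum.distrib sum_distrib_left distrib_left mult_ac)
    have "\<forall>\<^sub>F s in at_right 0. f k (v s) < F w" if "k \<in> I" for k
    proof (cases "k \<in> T")
      case True
      \<comment> \<open>Loads inside \<open>T\<close> may grow, but they start strictly below
        \<open>F w\<close> and depend continuously on \<open>s\<close>, so they stay below for small
        \<open>s\<close>.\<close>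
      have "((\<lambda>s. \<Sum>j\<in>J. c k j * ((1 - s) * w k + s * u k) / ((1 - s) * D w j + s * D u j) * p k j)
          \<longlongrightarrow> (\<Sum>j\<in>J. c k j * ((1 - 0) * w k + 0 * u k) / ((1 - 0) * D w j + 0 * D u j) * p k j)) (at_right 0)"
        using D_pos[OF w] by (intro tendsto_intros) (simp add: less_imp_neq[symmetric])
      then have "((\<lambda>s. f k (v s)) \<longlongrightarrow> f k w) (at_right 0)"
        by (simp add: f_def D_v) (simp add: v_def)
      then show ?thesis using True by (auto simp: T_def elim: order_tendstoD)
    next
      case False
      then have fk: "f k w = F w" using that F_ge[OF that, of w] by (simp add: T_def)
      then have wk: "w k > 0" using F_pos f_zero[of k] w_ge[of k] by force
      \<comment> \<open>Since \<open>u k = 0\<close>, the weight of \<open>k\<close> shrinks by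
        exactly the factor \<open>1 - s\<close>, whereas each denominator gains
        \<open>s * D u j > 0\<close> on top of \<open>(1 - s) * D w j\<close>. So every share of
        \<open>k\<close> drops strictly.\<close>
      have "f k (v s) < F w" if "0 < s" "s < 1" for s
      proof -
        have "c k j * v s k / D (v s) j * p k j < c k j * w k / D w j * p k j" if j: "j \<in> J" for j
        proof -
          have "v s k = (1 - s) * w k" using False by (simp add: v_def u_def)
          moreover have "(1 - s) * w k / D (v s) j < w k / D w j"
          proof -
            have "(1 - s) * D w j < D (v s) j"
              using D_pos[OF \<open>u \<in> K\<close> j] \<open>0 < s\<close> by (simp add: D_v)
            then show ?thesis
              using D_pos[OF w j] D_pos[OF v_in[of s] j] wk \<open>0 < s\<close> \<open>s < 1\<close>
              by (simp add: divide_simps mult.commute mult.left_commute)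
          qed
          ultimately have "c k j * (v s k / D (v s) j) * p k j < c k j * (w k / D w j) * p k j"
            using c[OF \<open>k \<in> I\<close> j] p[OF \<open>k \<in> I\<close> j]
            by (intro mult_strict_right_mono mult_strict_left_mono) simp_all
          then show ?thesis by simp
        qed
        then have "f k (v s) < f k w"
          unfolding f_def by (rule sum_strict_mono[OF J \<open>J \<noteq> {}\<close>])
        then show ?thesis using fk by simp
      qed
      then show ?thesis by (auto simp: eventually_at_right_field intro!: exI[of _ 1])
    qed
    then have "\<forall>\<^sub>F s in at_right 0. \<forall>k\<in>I. f k (v s) < F w"
      using I by (simp add: eventually_ball_finite)
    moreover have "\<forall>\<^sub>F s in at_right 0. 0 \<le> s \<and> s \<le> (1::real)"
      by (auto simp: eventually_at_right_field intro!: exI[of _ 1])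
    \<comment> \<open>As \<open>I\<close> is finite, one small \<open>s\<close> works for all
      agents, and \<open>F (v s) < F w\<close> contradicts minimality; \<open>at_right 0\<close> is
      a nontrivial filter, so nothing false can hold eventually.\<close>
    ultimately have "\<forall>\<^sub>F s in at_right (0::real). False"
    proof eventually_elim
      case (elim s)
      then have "F (v s) < F w" by (simp add: F_less)
      with w_min[OF v_in[of s]] elim show False by simp
    qed
    then show False by simp
  qed
  show thesis
  proof (rule that[of w "F w"])
    \<comment> \<open>A zero weight would give load 0, but all loads equal
      \<open>F w > 0\<close>.\<close>
    show "0 < w i" if "i \<in> I" for i
      using equal[OF that] F_pos f_zero[of i] w_ge[of i] by force
    show "(\<Sum>j\<in>J. c i j * w i / (\<Sum>k\<in>I. c k j * w k) * p i j) = F w" if "i \<in> I" for i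
      using equal[OF that] by (simp add: f_def D_def)
  qed
qed

section \<open>Soft minimum and soft maximum estimates\<close>

text \<open>A summand with \<open>q i\<close> at most \<open>(1 + \<delta>) * q k\<close> costs at
  most that much per unit of weight. For larger \<open>q i\<close> the summand is
  \<open>q i powr (a + 1)\<close> with nonpositive exponent, hence at most
  \<open>(1 + \<delta>) powr (a + 1)\<close> times the summand of \<open>k\<close>; all of these
  together cost a further \<open>\<delta>\<close>. As \<open>k\<close> is arbitrary, the weighted
  mean is compared with the minimum.\<close>

lemma sum_powr_le_argmin:
  fixes q :: "'a \<Rightarrow> real"
  assumes I: "finite I" "k \<in> I" and q: "\<And>i. i \<in> I \<Longrightarrow> 0 < q i"
    and "0 < \<delta>" and a: "a \<le> - 1" and small: "card I * (1 + \<delta>) powr (a + 1) \<le> \<delta>"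
  shows "(\<Sum>i\<in>I. q i powr a * q i) \<le> (1 + 2 * \<delta>) * q k * (\<Sum>i\<in>I. q i powr a)"
proof -
  define \<eta> where "\<eta> = (1 + \<delta>) powr (a + 1)"
  have "q i powr a * q i \<le> (1 + \<delta>) * q k * q i powr a + \<eta> * (q k powr a * q k)" if "i \<in> I" for i
  proof (cases "q i \<le> (1 + \<delta>) * q k")
    case True
    then have "q i powr a * q i \<le> (1 + \<delta>) * q k * q i powr a"
      by (metis mult.commute mult_left_mono powr_ge_zero)
    moreover have "0 \<le> \<eta> * (q k powr a * q k)" using q[OF I(2)] by (simp add: \<eta>_def)
    ultimately show ?thesis by linarith
  next
    case False
    have "q i powr a * q i = q i powr (a + 1)" using q[OF that] by (simp add: powr_add)
    also have "\<dots> \<le> ((1 + \<delta>) * q k) powr (a + 1)"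
      using False q[OF I(2)] \<open>0 < \<delta>\<close> a by (intro powr_mono2') auto
    also have "\<dots> = \<eta> * (q k powr a * q k)"
      using q[OF I(2)] \<open>0 < \<delta>\<close> by (simp add: \<eta>_def powr_mult powr_add)
    finally show ?thesis using q[OF I(2)] \<open>0 < \<delta>\<close> by (simp add: add_increasing)
  qed
  then have "(\<Sum>i\<in>I. q i powr a * q i)
      \<le> (\<Sum>i\<in>I. (1 + \<delta>) * q k * q i powr a + \<eta> * (q k powr a * q k))"
    by (rule sum_mono)
  also have "\<dots> = (1 + \<delta>) * q k * (\<Sum>i\<in>I. q i powr a) + card I * \<eta> * (q k powr a * q k)"
    by (simp add: sum.distrib sum_distrib_left)
  \<comment> \<open>The error terms are absorbed because \<open>q k powr a\<close> is itself one
    summand of the total weight.\<close>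
  also have "card I * \<eta> * (q k powr a * q k) \<le> \<delta> * ((\<Sum>i\<in>I. q i powr a) * q k)"
    using small q[OF I(2)] I \<open>0 < \<delta>\<close> unfolding \<eta>_def
    by (intro mult_mono mult_right_mono member_le_sum) auto
  finally show ?thesis by (simp add: algebra_simps)
qed

text \<open>Mirror image of the soft minimum bound: for \<open>a \<ge> 0\<close> the indices with
  \<open>q i\<close> below \<open>(1 - \<delta>) * q k\<close> carry a negligible part of the total
  weight, and the remaining ones have value at least \<open>(1 - \<delta>) * q k\<close>.\<close>

lemma sum_powr_ge_argmax:
  fixes q :: "'a \<Rightarrow> real"
  assumes I: "finite I" "k \<in> I" and q: "\<And>i. i \<in> I \<Longrightarrow> 0 < q i"
    and \<delta>: "0 < \<delta>" "\<delta> < 1" and a: "0 \<le> a" and small: "card I * (1 - \<delta>) powr (a + 1) \<le> \<delta>"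
  shows "(1 - 2 * \<delta>) * q k * (\<Sum>i\<in>I. q i powr a) \<le> (\<Sum>i\<in>I. q i powr a * q i)"
proof -
  define \<eta> where "\<eta> = (1 - \<delta>) powr (a + 1)"
  have "(1 - \<delta>) * q k * q i powr a \<le> q i powr a * q i + \<eta> * (q k powr a * q k)" if "i \<in> I" for i
  proof (cases "(1 - \<delta>) * q k \<le> q i")
    case True
    then have "(1 - \<delta>) * q k * q i powr a \<le> q i powr a * q i"
      by (metis mult.commute mult_left_mono powr_ge_zero)
    moreover have "0 \<le> \<eta> * (q k powr a * q k)" using q[OF I(2)] by (simp add: \<eta>_def)
    ultimately show ?thesis by linarith
  next
    case False
    \<comment> \<open>Monotonicity of \<open>powr a\<close> bounds the weight of \<open>i\<close>;
      the prefactor \<open>(1 - \<delta>) * q k\<close> then supplies the extra power that turns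
      \<open>a\<close> into \<open>a + 1\<close>.\<close>
    have "(1 - \<delta>) * q k * q i powr a \<le> (1 - \<delta>) * q k * ((1 - \<delta>) * q k) powr a"
      using False q[OF I(2)] q[OF that] \<delta> a by (intro mult_left_mono powr_mono2) auto
    also have "\<dots> = \<eta> * (q k powr a * q k)"
      using q[OF I(2)] \<delta> by (simp add: \<eta>_def powr_mult powr_add)
    finally show ?thesis using q[OF that] by (simp add: add_increasing)
  qed
  then have "(\<Sum>i\<in>I. (1 - \<delta>) * q k * q i powr a)
      \<le> (\<Sum>i\<in>I. q i powr a * q i + \<eta> * (q k powr a * q k))"
    by (rule sum_mono)
  also have "\<dots> = (\<Sum>i\<in>I. q i powr a * q i) + card I * \<eta> * (q k powr a * q k)"
    by (simp add: sum.distrib)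
  also have "card I * \<eta> * (q k powr a * q k) \<le> \<delta> * ((\<Sum>i\<in>I. q i powr a) * q k)"
    using small q[OF I(2)] I \<delta> unfolding \<eta>_def
    by (intro mult_mono mult_right_mono member_le_sum) auto
  finally have "(1 - \<delta>) * q k * (\<Sum>i\<in>I. q i powr a)
      \<le> (\<Sum>i\<in>I. q i powr a * q i) + \<delta> * ((\<Sum>i\<in>I. q i powr a) * q k)"
    by (simp add: sum_distrib_left)
  then show ?thesis by (simp add: algebra_simps)
qed

section \<open>Feasibility and equal loads of EP-allocations\<close>

lemma ep_allocation_feasible:
  assumes "m \<ge> 1" "\<forall>i<m. \<forall>j<n. 0 < P i j" "\<forall>i<m. 0 < w i"
  shows "feasible m n (ep_allocation m \<alpha> w P)"
proof -
  have pos: "0 < P i j powr \<alpha> * w i" if "i < m" "j < n" for i j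
    using assms(2,3) that by (metis less_irrefl mult_pos_pos powr_gt_zero)
  then have "0 < (\<Sum>i<m. P i j powr \<alpha> * w i)" if "j < n" for j
    using assms(1) that by (intro sum_pos) (auto simp: lessThan_empty_iff)
  moreover have "P i j powr \<alpha> * w i \<le> (\<Sum>i<m. P i j powr \<alpha> * w i)" if "i < m" "j < n" for i j
    using that pos by (intro member_le_sum) (auto simp: less_imp_le)
  ultimately show ?thesis
    using pos unfolding feasible_def ep_allocation_def
    by (force simp: less_imp_le divide_le_eq simp flip: sum_divide_distrib)
qed

text \<open>
  With \<open>l i = w i powr (1 / \<alpha>)\<close> the right-hand side is the total cost of the items at the prices
  \<open>l\<close>, each item being split in proportion to \<open>(l i * P i j) powr \<alpha>\<close>.
\<close>

lemma ex_ep_allocation_equal_loads: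
  assumes m: "m \<ge> 1" and P: "\<forall>i<m. \<forall>j<n. 0 < P i j" and \<alpha>: "\<alpha> \<noteq> 0"
  obtains w l L where "\<forall>i<m. 0 < w i" "\<forall>i<m. 0 < l i"
    "\<forall>i<m. load n P (ep_allocation m \<alpha> w P) i = L"
    "L * (\<Sum>i<m. l i) = (\<Sum>j<n. (\<Sum>i<m. (l i * P i j) powr \<alpha> * (l i * P i j)) / (\<Sum>i<m. (l i * P i j) powr \<alpha>))"
proof -
  obtain w L where w: "\<And>i. i < m \<Longrightarrow> 0 < w i"
    and "\<And>i. i < m \<Longrightarrow> (\<Sum>j<n. P i j powr \<alpha> * w i / (\<Sum>k<m. P k j powr \<alpha> * w k) * P i j) = L"
  proof (rule ex_weights_equal_loads[of "{..<m}" "{..<n}" "\<lambda>i j. P i j powr \<alpha>" P])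
    show "0 < P i j powr \<alpha>" "0 < P i j" if "i \<in> {..<m}" "j \<in> {..<n}" for i j
      using P that by (simp_all add: order.strict_implies_not_eq[symmetric])
  qed (use m in \<open>auto simp: lessThan_empty_iff\<close>)
  then have L: "\<And>i. i < m \<Longrightarrow> load n P (ep_allocation m \<alpha> w P) i = L"
    by (simp add: load_def ep_allocation_def)
  define l where "l i = w i powr (1 / \<alpha>)" for i
  have l: "0 < l i" if "i < m" for i using w[OF that] by (simp add: l_def)
  have eq: "(l i * P i j) powr \<alpha> = P i j powr \<alpha> * w i" if "i < m" "j < n" for i j
    using w[OF that(1)] P that \<alpha> by (simp add: l_def powr_mult powr_powr)
  have "L * (\<Sum>i<m. l i) = (\<Sum>i<m. l i * load n P (ep_allocation m \<alpha> w P) i)"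
    using L by (simp add: sum_distrib_left mult.commute)
  also have "\<dots> = (\<Sum>i<m. \<Sum>j<n. ep_allocation m \<alpha> w P i j * (l i * P i j))"
    by (simp add: load_def sum_distrib_left mult_ac)
  also have "\<dots> = (\<Sum>j<n. \<Sum>i<m. ep_allocation m \<alpha> w P i j * (l i * P i j))"
    by (rule sum.swap)
  also have "\<dots> = (\<Sum>j<n. (\<Sum>i<m. (l i * P i j) powr \<alpha> * (l i * P i j)) / (\<Sum>i<m. (l i * P i j) powr \<alpha>))"
    by (simp add: ep_allocation_def eq sum_divide_distrib cong: sum.cong_simp)
  finally show thesis using that w l L by blast
qed

section \<open>Competitive ratios at a fixed exponent by duality\<close>

text \<open>Passes from priced loads of agents, which are bounded by the maximal or minimal load, to
  priced costs of items, where the soft minimum and maximum bounds apply.\<close>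

lemma weighted_load_eq:
  "(\<Sum>i<m. l i * load n P X i) = (\<Sum>j<n. \<Sum>k<m. X k j * (l k * P k j))"
proof -
  have "(\<Sum>i<m. l i * load n P X i) = (\<Sum>i<m. \<Sum>j<n. X i j * (l i * P i j))"
    by (simp add: load_def sum_distrib_left mult_ac)
  also have "\<dots> = (\<Sum>j<n. \<Sum>k<m. X k j * (l k * P k j))"
    by (rule sum.swap)
  finally show ?thesis .
qed

lemma load_le_max_load: "i < m \<Longrightarrow> load n P X i \<le> max_load m n P X"
  by (simp add: max_load_def)

lemma min_load_le_load: "i < m \<Longrightarrow> min_load m n P X \<le> load n P X i"
  by (simp add: min_load_def)

text \<open>The soft minimum bound is applied with \<open>\<delta> = \<epsilon> / 2\<close>. The
  condition on \<open>\<alpha>\<close> mentions only \<open>m\<close> and \<open>\<epsilon>\<close>,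
  so one exponent serves all \<open>n\<close> and \<open>P\<close>.\<close>

lemma load_balancing_ep:
  assumes m: "m \<ge> 1" and "\<epsilon> > 0" and P: "\<forall>i<m. \<forall>j<n. 0 < P i j"
    and \<alpha>: "\<alpha> \<le> - 1" "m * (1 + \<epsilon> / 2) powr (\<alpha> + 1) \<le> \<epsilon> / 2"
  shows "\<exists>w. (\<forall>i<m. 0 < w i) \<and> load_balancing_competitive (1 + \<epsilon>) m n P (ep_allocation m \<alpha> w P)"
proof -
  obtain w l L where w: "\<forall>i<m. 0 < w i" and l: "\<forall>i<m. 0 < l i"
    and L: "\<forall>i<m. load n P (ep_allocation m \<alpha> w P) i = L"
    and eq: "L * (\<Sum>i<m. l i) = (\<Sum>j<n. (\<Sum>i<m. (l i * P i j) powr \<alpha> * (l i * P i j)) / (\<Sum>i<m. (l i * P i j) powr \<alpha>))"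
    using ex_ep_allocation_equal_loads[OF m P, of \<alpha>] \<alpha> by auto
  have feas: "feasible m n (ep_allocation m \<alpha> w P)"
    by (rule ep_allocation_feasible[OF m P w])
  have "(load n P (ep_allocation m \<alpha> w P)) ` {..<m} = {L}"
    using L m by (auto simp: image_iff intro!: exI[of _ 0])
  then have max: "max_load m n P (ep_allocation m \<alpha> w P) = L"
    by (simp add: max_load_def)
  have l_pos: "0 < (\<Sum>i<m. l i)"
    using l m by (intro sum_pos) (auto simp: lessThan_empty_iff)
  have "L \<le> (1 + \<epsilon>) * max_load m n P X" if X: "feasible m n X" for X
  proof -
    \<comment> \<open>The bound for \<open>?r\<close> holds for every agent \<open>k\<close>;
      averaging it with the fractions \<open>X k j\<close>, which sum to 1, compares the EP split of
      item \<open>j\<close> with the split by \<open>X\<close>.\<close>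
    have item: "(\<Sum>i<m. (l i * P i j) powr \<alpha> * (l i * P i j)) / (\<Sum>i<m. (l i * P i j) powr \<alpha>)
        \<le> (\<Sum>k<m. X k j * ((1 + \<epsilon>) * (l k * P k j)))" (is "?r \<le> _") if j: "j < n" for j
    proof -
      have S: "0 < (\<Sum>i<m. (l i * P i j) powr \<alpha>)"
      proof (intro sum_pos)
        show "0 < (l i * P i j) powr \<alpha>" if "i \<in> {..<m}" for i
          using l P j that by (metis lessThan_iff less_irrefl mult_pos_pos powr_gt_zero)
      qed (use m in \<open>auto simp: lessThan_empty_iff\<close>)
      have "?r \<le> (1 + \<epsilon>) * (l k * P k j)" if "k < m" for k
        using sum_powr_le_argmin[of "{..<m}" k "\<lambda>i. l i * P i j" "\<epsilon> / 2" \<alpha>]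
          that j l P \<open>\<epsilon> > 0\<close> \<alpha> S by (simp add: divide_le_eq)
      then have "(\<Sum>k<m. X k j * ?r) \<le> (\<Sum>k<m. X k j * ((1 + \<epsilon>) * (l k * P k j)))"
        using X j by (intro sum_mono mult_left_mono) (auto simp: feasible_def)
      moreover have "(\<Sum>k<m. X k j * r) = r" for r
        using X j sum_distrib_right[of "\<lambda>k. X k j" "{..<m}" r] by (simp add: feasible_def)
      ultimately show ?thesis by (simp only:)
    qed
    have "L * (\<Sum>i<m. l i) \<le> (\<Sum>j<n. \<Sum>k<m. X k j * ((1 + \<epsilon>) * (l k * P k j)))"
      unfolding eq by (intro sum_mono item) simp
    also have "\<dots> = (1 + \<epsilon>) * (\<Sum>i<m. l i * load n P X i)"
      by (simp add: weighted_load_eq sum_distrib_left mult_ac)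
    also have "\<dots> \<le> (1 + \<epsilon>) * (\<Sum>i<m. l i * max_load m n P X)"
      using l \<open>\<epsilon> > 0\<close> by (intro mult_left_mono sum_mono load_le_max_load) (auto simp: less_imp_le)
    also have "\<dots> = (1 + \<epsilon>) * max_load m n P X * (\<Sum>i<m. l i)"
      by (simp add: mult_ac flip: sum_distrib_right)
    finally show ?thesis using l_pos by simp
  qed
  \<comment> \<open>Now \<open>L / (1 + \<epsilon>)\<close> is a lower bound for all maximal loads;
    the EP-allocation witnesses that the infimum is over a nonempty set.\<close>
  then have "L / (1 + \<epsilon>) \<le> opt_load_balancing m n P"
    unfolding opt_load_balancing_def using feas \<open>\<epsilon> > 0\<close>
    by (intro cINF_greatest) (auto simp: divide_le_eq mult.commute)
  then have "L \<le> (1 + \<epsilon>) * opt_load_balancing m n P"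
    using \<open>\<epsilon> > 0\<close> by (simp add: divide_le_eq mult.commute)
  with w feas max show ?thesis by (auto simp: load_balancing_competitive_def)
qed

text \<open>The ratio \<open>1 - 2 * \<delta>\<close> is proved first, where
  \<open>\<delta> < 1 / 2\<close> permits division by it. The separate \<open>\<epsilon>\<close>
  covers large values, for which \<open>1 - \<epsilon>\<close> may be nonpositive.\<close>

lemma santa_claus_ep:
  assumes m: "m \<ge> 1" and \<delta>: "0 < \<delta>" "\<delta> < 1 / 2" and P: "\<forall>i<m. \<forall>j<n. 0 < P i j"
    and \<alpha>: "0 < \<alpha>" "m * (1 - \<delta>) powr (\<alpha> + 1) \<le> \<delta>" and \<epsilon>: "2 * \<delta> \<le> \<epsilon>"
  shows "\<exists>w. (\<forall>i<m. 0 < w i) \<and> santa_claus_competitive (1 - \<epsilon>) m n P (ep_allocation m \<alpha> w P)"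
proof -
  obtain w l L where w: "\<forall>i<m. 0 < w i" and l: "\<forall>i<m. 0 < l i"
    and L: "\<forall>i<m. load n P (ep_allocation m \<alpha> w P) i = L"
    and eq: "L * (\<Sum>i<m. l i) = (\<Sum>j<n. (\<Sum>i<m. (l i * P i j) powr \<alpha> * (l i * P i j)) / (\<Sum>i<m. (l i * P i j) powr \<alpha>))"
    using ex_ep_allocation_equal_loads[OF m P, of \<alpha>] \<alpha> by auto
  have feas: "feasible m n (ep_allocation m \<alpha> w P)"
    by (rule ep_allocation_feasible[OF m P w])
  have "(load n P (ep_allocation m \<alpha> w P)) ` {..<m} = {L}"
    using L m by (auto simp: image_iff intro!: exI[of _ 0])
  then have min: "min_load m n P (ep_allocation m \<alpha> w P) = L"
    by (simp add: min_load_def)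
  have l_pos: "0 < (\<Sum>i<m. l i)"
    using l m by (intro sum_pos) (auto simp: lessThan_empty_iff)
  have "0 \<le> L * (\<Sum>i<m. l i)"
    unfolding eq using l P by (intro sum_nonneg divide_nonneg_nonneg mult_nonneg_nonneg) (auto simp: less_imp_le)
  then have "0 \<le> L" using l_pos by (simp add: zero_le_mult_iff)
  have bound: "min_load m n P X \<le> L / (1 - 2 * \<delta>)" if X: "feasible m n X" for X
  proof -
    \<comment> \<open>As for load balancing, but each agent's discounted price lies below
      \<open>?r\<close>, and so does their average under \<open>X\<close>.\<close>
    have item: "(\<Sum>k<m. X k j * ((1 - 2 * \<delta>) * (l k * P k j)))
        \<le> (\<Sum>i<m. (l i * P i j) powr \<alpha> * (l i * P i j)) / (\<Sum>i<m. (l i * P i j) powr \<alpha>)" (is "_ \<le> ?r")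
      if j: "j < n" for j
    proof -
      have S: "0 < (\<Sum>i<m. (l i * P i j) powr \<alpha>)"
      proof (intro sum_pos)
        show "0 < (l i * P i j) powr \<alpha>" if "i \<in> {..<m}" for i
          using l P j that by (metis lessThan_iff less_irrefl mult_pos_pos powr_gt_zero)
      qed (use m in \<open>auto simp: lessThan_empty_iff\<close>)
      have "(1 - 2 * \<delta>) * (l k * P k j) \<le> ?r" if "k < m" for k
        using sum_powr_ge_argmax[of "{..<m}" k "\<lambda>i. l i * P i j" \<delta> \<alpha>]
          that j l P \<delta> \<alpha> S by (simp add: le_divide_eq)
      then have "(\<Sum>k<m. X k j * ((1 - 2 * \<delta>) * (l k * P k j))) \<le> (\<Sum>k<m. X k j * ?r)"
        using X j by (intro sum_mono mult_left_mono) (auto simp: feasible_def)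
      moreover have "(\<Sum>k<m. X k j * r) = r" for r
        using X j sum_distrib_right[of "\<lambda>k. X k j" "{..<m}" r] by (simp add: feasible_def)
      ultimately show ?thesis by (simp only:)
    qed
    have "(\<Sum>j<n. \<Sum>k<m. X k j * ((1 - 2 * \<delta>) * (l k * P k j))) \<le> L * (\<Sum>i<m. l i)"
      unfolding eq by (intro sum_mono item) simp
    moreover have "(\<Sum>j<n. \<Sum>k<m. X k j * ((1 - 2 * \<delta>) * (l k * P k j)))
        = (1 - 2 * \<delta>) * (\<Sum>i<m. l i * load n P X i)"
      by (simp add: weighted_load_eq sum_distrib_left mult_ac)
    moreover have "(1 - 2 * \<delta>) * (\<Sum>i<m. l i * min_load m n P X)
        \<le> (1 - 2 * \<delta>) * (\<Sum>i<m. l i * load n P X i)"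
      using l \<delta> by (intro mult_left_mono sum_mono min_load_le_load) (auto simp: less_imp_le)
    moreover have "(1 - 2 * \<delta>) * (\<Sum>i<m. l i * min_load m n P X)
        = (1 - 2 * \<delta>) * min_load m n P X * (\<Sum>i<m. l i)"
      by (simp add: mult_ac flip: sum_distrib_right)
    ultimately have "(1 - 2 * \<delta>) * min_load m n P X * (\<Sum>i<m. l i) \<le> L * (\<Sum>i<m. l i)"
      by linarith
    then have "(1 - 2 * \<delta>) * min_load m n P X \<le> L" using l_pos by simp
    then show ?thesis using \<delta> by (simp add: le_divide_eq mult.commute)
  qed
  then have "opt_santa_claus m n P \<le> L / (1 - 2 * \<delta>)"
    unfolding opt_santa_claus_def using feas by (intro cSUP_least) auto
  then have "(1 - 2 * \<delta>) * opt_santa_claus m n P \<le> L"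
    using \<delta> by (simp add: le_divide_eq mult.commute)
  \<comment> \<open>The EP-allocation is itself feasible and \<open>bound\<close> makes the supremum
    finite. Hence the optimum is at least \<open>L \<ge> 0\<close>, which allows weakening
    \<open>1 - 2 * \<delta>\<close> to \<open>1 - \<epsilon>\<close>.\<close>
  moreover have "L \<le> opt_santa_claus m n P"
    unfolding opt_santa_claus_def min[symmetric] using feas bound
    by (intro cSUP_upper bdd_aboveI2) auto
  then have "(1 - \<epsilon>) * opt_santa_claus m n P \<le> (1 - 2 * \<delta>) * opt_santa_claus m n P"
    using \<open>0 \<le> L\<close> \<epsilon> by (intro mult_right_mono) auto
  ultimately show ?thesis using w feas min by (auto simp: santa_claus_competitive_def)
qed

section \<open>Choice of the exponents\<close>

lemma ex_nat_powr_le: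
  fixes b d c :: real
  assumes "0 < b" "b < 1" "0 < d" "0 < c"
  obtains N :: nat where "c * b powr N \<le> d"
proof -
  obtain N where "b ^ N < d / c"
    using real_arch_pow_inv[of "d / c" b] assms by auto
  then show thesis
    using that[of N] assms by (simp add: powr_realpow less_divide_eq mult.commute)
qed

theorem theorem2p1:
  fixes m :: nat and \<epsilon> :: real
  assumes "m \<ge> 1" and "\<epsilon> > 0"
  shows "(\<exists>\<alpha>::real. \<forall>n (P :: nat \<Rightarrow> nat \<Rightarrow> real). (\<forall>i<m. \<forall>j<n. P i j > 0) \<longrightarrow>
            (\<exists>w :: nat \<Rightarrow> real. (\<forall>i<m. w i > 0) \<and>
               load_balancing_competitive (1 + \<epsilon>) m n P (ep_allocation m \<alpha> w P))) \<and>
         (\<exists>\<alpha>::real. \<forall>n (P :: nat \<Rightarrow> nat \<Rightarrow> real). (\<forall>i<m. \<forall>j<n. P i j > 0) \<longrightarrow>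
            (\<exists>w :: nat \<Rightarrow> real. (\<forall>i<m. w i > 0) \<and>
               santa_claus_competitive (1 - \<epsilon>) m n P (ep_allocation m \<alpha> w P)))"
proof (intro conjI)
  obtain N :: nat where "m * (1 / (1 + \<epsilon> / 2)) powr N \<le> \<epsilon> / 2"
    using ex_nat_powr_le[of "1 / (1 + \<epsilon> / 2)" "\<epsilon> / 2" m] assms by auto
  moreover have "(1 / (1 + \<epsilon> / 2)) powr N = (1 + \<epsilon> / 2) powr (- N)"
    using assms by (simp add: powr_divide powr_minus_divide)
  \<comment> \<open>The exponent is \<open>- N - 1\<close>: it is at most -1, and adding 1 leaves
    exactly the decaying power \<open>- N\<close>.\<close>
  ultimately have "m * (1 + \<epsilon> / 2) powr ((- real N - 1) + 1) \<le> \<epsilon> / 2" by simp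
  then show "\<exists>\<alpha>::real. \<forall>n (P :: nat \<Rightarrow> nat \<Rightarrow> real). (\<forall>i<m. \<forall>j<n. P i j > 0) \<longrightarrow>
      (\<exists>w :: nat \<Rightarrow> real. (\<forall>i<m. w i > 0) \<and>
         load_balancing_competitive (1 + \<epsilon>) m n P (ep_allocation m \<alpha> w P))"
    using load_balancing_ep[OF assms] by (intro exI[of _ "- real N - 1"]) auto
next
  \<comment> \<open>The cap \<open>1 / 3\<close> keeps \<open>\<delta>\<close> below
    \<open>1 / 2\<close> when \<open>\<epsilon>\<close> is large.\<close>
  define \<delta> where "\<delta> = min (\<epsilon> / 2) (1 / 3)"
  have \<delta>: "0 < \<delta>" "\<delta> < 1 / 2" "2 * \<delta> \<le> \<epsilon>" using assms by (auto simp: \<delta>_def)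
  obtain N :: nat where N: "m * (1 - \<delta>) powr N \<le> \<delta>"
    using ex_nat_powr_le[of "1 - \<delta>" \<delta> m] assms \<delta> by auto
  \<comment> \<open>\<open>Suc N\<close> instead of \<open>N\<close> makes the exponent positive; a
    larger exponent only decreases a power of a base below 1.\<close>
  have "(1 - \<delta>) powr (real (Suc N) + 1) \<le> (1 - \<delta>) powr N"
    using \<delta> by (intro powr_mono') auto
  then have "m * (1 - \<delta>) powr (real (Suc N) + 1) \<le> \<delta>"
    using N by (meson mult_left_mono of_nat_0_le_iff order_trans)
  then show "\<exists>\<alpha>::real. \<forall>n (P :: nat \<Rightarrow> nat \<Rightarrow> real). (\<forall>i<m. \<forall>j<n. P i j > 0) \<longrightarrow>
      (\<exists>w :: nat \<Rightarrow> real. (\<forall>i<m. w i > 0) \<and>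
         santa_claus_competitive (1 - \<epsilon>) m n P (ep_allocation m \<alpha> w P))"
    using santa_claus_ep[OF assms(1) \<delta>(1,2) _ _ _ \<delta>(3), of _ _ "real (Suc N)"]
    by (intro exI[of _ "real (Suc N)"]) auto
qed

end
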